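(* Let $X$ be a proper, geodesic, $\delta$-hyperbolic metric space and let $\Gamma < \mathrm{Isom}(X)$ be discrete. Let $\mu$ be an ergodic, $\Phi_1$-invariant, Borel probability measure on $\mathrm{Proj\text{-}Geod}(\Gamma\backslash X)$. Then $\mu$ is concentrated on the set of equivalence classes of geodesics with endpoints belonging to $\Lambda_{\mathrm{erg}}(\Gamma)$, that is, for $\mu$-almost every $[\gamma]\in \mathrm{Proj\text{-}Geod}(\Gamma\backslash X)$ both $\gamma^+$ and $\gamma^-$ belong to $\Lambda_{\mathrm{erg}}(\Gamma)$.
   Context: Hyperbolicity. For a geodesic metric space $X$ and $x,y,z\in X$ put $(y,z)_x=\frac12\big(d(x,y)+d(x,z)-d(y,z)\big)$. $X$ is $\delta$-hyperbolic ($\delta\ge 0$) if $(x,z)_w\ge\min\{(x,y)_w,(y,z)_w\}-\delta$ for all $x,y,z,w\in X$. Proper means that closed balls are compact. Boundary. $\partial X$ is the set of sequences $(z_n)$ in $X$ with $\lim_{n,m\to+\infty}(z_n,z_m)_x=+\infty$, modulo the relation $(z_n)\sim(z_n')$ iff $\lim_{n,m\to+\infty}(z_n,z'_m)_x=+\infty$. This does not depend on $x$. A geodesic ray is an isometric embedding $\xi:[0,+\infty)\to X$; its endpoint is $\xi^+=[(\xi(n))_n]\in\partial X$. A geodesic ray $\xi$ with $\xi(0)=x$ and $\xi^+=z$ is denoted $[x,z]$ (it exists for all $x\in X$, $z\in\partial X$, but need not be unique). Groups. $\mathrm{Isom}(X)$ is the isometry group of $X$. $\Gamma<\mathrm{Isom}(X)$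 is discrete if for every $x\in X$ and $R\ge0$ the set $\{g\in\Gamma: d(x,gx)\le R\}$ is finite. Ergodic limit set. Fix $x\in X$. For $\tau>0$ and an increasing sequence $\Theta=\{\vartheta_i\}_{i\in\mathbb N}$ of real numbers with $\vartheta_i\to+\infty$, let $\Lambda_{\tau,\Theta}(\Gamma)$ be the set of $z\in\partial X$ such that there exists a geodesic ray $[x,z]$ with the property: for every $i\in\mathbb N$ there is a point $y_i\in[x,z]$ with $d(x,y_i)\in[\vartheta_i,\vartheta_{i+1}]$ and $d(y_i,\Gamma x)\le\tau$. Let $\Theta_{\mathrm{erg}}$ be the set of such sequences $\Theta$ for which $\lim_{i\to+\infty}\vartheta_i/i$ exists and belongs to $(0,+\infty)$. The ergodic limit set is $\Lambda_{\mathrm{erg}}(\Gamma)=\bigcup_{\tau>0}\bigcup_{\Theta\in\Theta_{\mathrm{erg}}}\Lambda_{\tau,\Theta}(\Gamma)$; it is $\Gamma$-invariant and does not depend on $x$. Geodesic flow. $\mathrm{Geod}(X)$ is the set of isometric embeddings $\gamma:\mathbb R\to X$ (geodesic lines), with the topology of uniform convergence on compact subsets of $\mathbb R$. For $\gamma\in\mathrm{Geod}(X)$, $\gamma^+=[(\gamma(n))_n]$ and $\gamma^-=[(\gamma(-n))_n]$ in $\partial X$. $\Gamma$ acts on $\mathrm{Geod}(X)$ by homeomorphisms via $(g\gamma)(\cdot)=g(\gamma(\cdot))$, and $\mathrm{Proj\text{-}Geod}(\Gamma\backslash X):=\Gamma\backslash\mathrm{Geod}(X)$ with the quotient topology; $[\gamma]$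 denotes the class of $\gamma$. The flow $\Phi_t\gamma(\cdot)=\gamma(\cdot+t)$, $t\in\mathbb R$, commutes with $\Gamma$ and so induces a flow, still denoted $\Phi_t$, on $\mathrm{Proj\text{-}Geod}(\Gamma\backslash X)$. A Borel probability measure $\mu$ is $\Phi_1$-invariant if $(\Phi_1)_\#\mu=\mu$; it is ergodic if moreover $\mu(A)\in\{0,1\}$ for every Borel set $A$ with $\Phi_1^{-1}(A)\subseteq A$. The condition $\gamma^\pm\in\Lambda_{\mathrm{erg}}(\Gamma)$ does not depend on the representative of $[\gamma]$, by $\Gamma$-invariance of $\Lambda_{\mathrm{erg}}(\Gamma)$. "$\mu$-almost every" means outside a set contained in a Borel set of $\mu$-measure $0$. *)

theory Defs
  imports "HOL-Analysis.Analysis" "HOL-Probability.Probability" "HOL-Algebra.Group"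
begin

text \<open>The metric space \<open>X\<close> is the whole of a type of class \<open>metric_space\<close>.\<close>

definition isometric_on :: "'a::metric_space set \<Rightarrow> ('a \<Rightarrow> 'b::metric_space) \<Rightarrow> bool" where
  "isometric_on S f \<longleftrightarrow> (\<forall>s\<in>S. \<forall>t\<in>S. dist (f s) (f t) = dist s t)"

definition proper_space :: "'a::metric_space itself \<Rightarrow> bool" where
  "proper_space _ \<longleftrightarrow> (\<forall>(x::'a) r. compact (cball x r))"

definition geodesic_space :: "'a::metric_space itself \<Rightarrow> bool" where
  "geodesic_space _ \<longleftrightarrow>
     (\<forall>x y :: 'a. \<exists>c :: real \<Rightarrow> 'a. isometric_on {0..dist x y} c \<and> c 0 = x \<and> c (dist x y) = y)"

text \<open>\<open>gromov_product x y z\<close> is \<open>(y,z)\<^sub>x\<close>: the base point comes first.\<close>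

definition gromov_product :: "'a::metric_space \<Rightarrow> 'a \<Rightarrow> 'a \<Rightarrow> real" where
  "gromov_product x y z = (dist x y + dist x z - dist y z) / 2"

definition hyperbolic_space :: "'a::metric_space itself \<Rightarrow> real \<Rightarrow> bool" where
  "hyperbolic_space _ \<delta> \<longleftrightarrow>
     (\<forall>x y z w :: 'a. gromov_product w x z \<ge>
        min (gromov_product w x y) (gromov_product w y z) - \<delta>)"

text \<open>\<open>x\<close> is the base point throughout; points of the boundary are equivalence classes of
  sequences.\<close>

definition gromov_related :: "'a::metric_space \<Rightarrow> (nat \<Rightarrow> 'a) \<Rightarrow> (nat \<Rightarrow> 'a) \<Rightarrow> bool" where
  "gromov_related x u v \<longleftrightarrow>
     filterlim (\<lambda>(n, m). gromov_product x (u n) (v m)) at_top (sequentially \<times>\<^sub>F sequentially)"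

definition gromov_sequences :: "'a::metric_space \<Rightarrow> (nat \<Rightarrow> 'a) set" where
  "gromov_sequences x = {u. gromov_related x u u}"

definition boundary_rel :: "'a::metric_space \<Rightarrow> ((nat \<Rightarrow> 'a) \<times> (nat \<Rightarrow> 'a)) set" where
  "boundary_rel x =
     {(u, v). u \<in> gromov_sequences x \<and> v \<in> gromov_sequences x \<and> gromov_related x u v}"

definition boundary :: "'a::metric_space \<Rightarrow> (nat \<Rightarrow> 'a) set set" where
  "boundary x = gromov_sequences x // boundary_rel x"

definition boundary_class :: "'a::metric_space \<Rightarrow> (nat \<Rightarrow> 'a) \<Rightarrow> (nat \<Rightarrow> 'a) set" where
  "boundary_class x u = boundary_rel x `` {u}"

definition pos_end :: "'a::metric_space \<Rightarrow> (real \<Rightarrow> 'a) \<Rightarrow> (nat \<Rightarrow> 'a) set" where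
  "pos_end x \<gamma> = boundary_class x (\<lambda>n. \<gamma> (real n))"

definition neg_end :: "'a::metric_space \<Rightarrow> (real \<Rightarrow> 'a) \<Rightarrow> (nat \<Rightarrow> 'a) set" where
  "neg_end x \<gamma> = boundary_class x (\<lambda>n. \<gamma> (- real n))"

text \<open>Geodesic rays are functions on all of \<open>\<real>\<close> of which only the values on \<open>[0,\<infinity>)\<close> matter.\<close>

definition geodesic_ray :: "(real \<Rightarrow> 'a::metric_space) \<Rightarrow> bool" where
  "geodesic_ray \<xi> \<longleftrightarrow> isometric_on {0..} \<xi>"

definition isom_group :: "('a::metric_space \<Rightarrow> 'a) monoid" where
  "isom_group = \<lparr>carrier = {g. bij g \<and> isometric_on UNIV g}, mult = (\<circ>), one = id\<rparr>"

lemma group_isom_group: "group (isom_group :: ('a::metric_space \<Rightarrow> 'a) monoid)"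
proof (rule groupI)
  fix g :: "'a \<Rightarrow> 'a" assume g: "g \<in> carrier isom_group"
  then have "inv_into UNIV g \<in> carrier isom_group"
    by (auto simp: isom_group_def isometric_on_def bij_imp_bij_inv)
       (metis bij_inv_eq_iff)
  moreover have "inv_into UNIV g \<circ> g = id"
    using g by (simp add: isom_group_def bij_is_inj)
  ultimately show "\<exists>h\<in>carrier isom_group. h \<otimes>\<^bsub>isom_group\<^esub> g = \<one>\<^bsub>isom_group\<^esub>"
    by (auto simp: isom_group_def)
qed (auto simp: isom_group_def isometric_on_def bij_comp o_assoc)

definition discrete_isometries :: "('a::metric_space \<Rightarrow> 'a) set \<Rightarrow> bool" where
  "discrete_isometries \<Gamma> \<longleftrightarrow> (\<forall>x. \<forall>R\<ge>0. finite {g \<in> \<Gamma>. dist x (g x) \<le> R})"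

text \<open>\<open>infdist\<close> to the orbit is the genuine distance: a subgroup is nonempty (\<open>infdist\<close> to the
  empty set would be \<open>0\<close>).\<close>

definition limit_set_along ::
    "('a::metric_space \<Rightarrow> 'a) set \<Rightarrow> 'a \<Rightarrow> real \<Rightarrow> (nat \<Rightarrow> real) \<Rightarrow> (nat \<Rightarrow> 'a) set set" where
  "limit_set_along \<Gamma> x \<tau> \<theta> =
     {z \<in> boundary x. \<exists>\<xi>. geodesic_ray \<xi> \<and> \<xi> 0 = x \<and> pos_end x \<xi> = z \<and>
        (\<forall>i. \<exists>y \<in> \<xi> ` {0..}. dist x y \<in> {\<theta> i..\<theta> (Suc i)} \<and> infdist y ((\<lambda>g. g x) ` \<Gamma>) \<le> \<tau>)}"

definition ergodic_sequences :: "(nat \<Rightarrow> real) set" where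
  "ergodic_sequences =
     {\<theta>. strict_mono \<theta> \<and> filterlim \<theta> at_top sequentially \<and>
         (\<exists>L>0. (\<lambda>i. \<theta> i / real i) \<longlonglongrightarrow> L)}"

definition ergodic_limit_set ::
    "('a::metric_space \<Rightarrow> 'a) set \<Rightarrow> 'a \<Rightarrow> (nat \<Rightarrow> 'a) set set" where
  "ergodic_limit_set \<Gamma> x = (\<Union>\<tau>\<in>{0<..}. \<Union>\<theta>\<in>ergodic_sequences. limit_set_along \<Gamma> x \<tau> \<theta>)"

definition Geod :: "(real \<Rightarrow> 'a::metric_space) set" where
  "Geod = {\<gamma>. isometric_on UNIV \<gamma>}"

definition geod_nhd :: "(real \<Rightarrow> 'a::metric_space) \<Rightarrow> real set \<Rightarrow> real \<Rightarrow> (real \<Rightarrow> 'a) set" where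
  "geod_nhd \<gamma> K e = {\<eta> \<in> Geod. \<forall>t\<in>K. dist (\<gamma> t) (\<eta> t) < e}"

text \<open>The topology of uniform convergence on compact subsets of \<open>\<real>\<close>.\<close>

definition geod_open :: "(real \<Rightarrow> 'a::metric_space) set \<Rightarrow> bool" where
  "geod_open U \<longleftrightarrow> U \<subseteq> Geod \<and> (\<forall>\<gamma>\<in>U. \<exists>K. compact K \<and> (\<exists>e>0. geod_nhd \<gamma> K e \<subseteq> U))"

definition geod_topology :: "(real \<Rightarrow> 'a::metric_space) topology" where
  "geod_topology = topology geod_open"

lemma istopology_geod_open: "istopology (geod_open :: (real \<Rightarrow> 'a::metric_space) set \<Rightarrow> bool)"
  unfolding istopology_def
proof (intro conjI allI impI)
  fix S T :: "(real \<Rightarrow> 'a) set" assume ST: "geod_open S" "geod_open T"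
  show "geod_open (S \<inter> T)"
    unfolding geod_open_def
  proof (intro conjI ballI)
    show "S \<inter> T \<subseteq> Geod" using ST by (auto simp: geod_open_def)
    fix \<gamma> assume "\<gamma> \<in> S \<inter> T"
    then obtain K e L d where "compact K" "e > 0" "geod_nhd \<gamma> K e \<subseteq> S"
        "compact L" "d > 0" "geod_nhd \<gamma> L d \<subseteq> T"
      using ST unfolding geod_open_def by blast
    then have "compact (K \<union> L)" "min e d > 0" "geod_nhd \<gamma> (K \<union> L) (min e d) \<subseteq> S \<inter> T"
      by (auto simp: geod_nhd_def)
    then show "\<exists>K. compact K \<and> (\<exists>e>0. geod_nhd \<gamma> K e \<subseteq> S \<inter> T)" by blast
  qed
next
  fix \<K> :: "(real \<Rightarrow> 'a) set set" assume "\<forall>U\<in>\<K>. geod_open U"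
  then show "geod_open (\<Union>\<K>)"
    unfolding geod_open_def by (meson Union_iff Union_least Union_upper subset_trans)
qed

lemma openin_geod_topology [simp]: "openin geod_topology = geod_open"
  by (simp add: geod_topology_def istopology_geod_open)

lemma geod_open_Geod: "geod_open Geod"
  unfolding geod_open_def geod_nhd_def by (auto intro!: exI[of _ "{}"] exI[of _ "1::real"])

lemma topspace_geod_topology [simp]: "topspace geod_topology = Geod"
  using geod_open_Geod by (auto simp: topspace_def geod_open_def)

definition quotient_topology :: "'a topology \<Rightarrow> ('a \<Rightarrow> 'b) \<Rightarrow> 'b topology" where
  "quotient_topology T f =
     topology (\<lambda>V. V \<subseteq> f ` topspace T \<and> openin T {x \<in> topspace T. f x \<in> V})"

lemma openin_quotient_topology:
  "openin (quotient_topology T f) V \<longleftrightarrow>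
     V \<subseteq> f ` topspace T \<and> openin T {x \<in> topspace T. f x \<in> V}"
proof -
  have "istopology (\<lambda>V. V \<subseteq> f ` topspace T \<and> openin T {x \<in> topspace T. f x \<in> V})"
    unfolding istopology_def
  proof (rule conjI; clarify)
    fix S U assume "openin T {x \<in> topspace T. f x \<in> S}" "openin T {x \<in> topspace T. f x \<in> U}"
    then have "openin T ({x \<in> topspace T. f x \<in> S} \<inter> {x \<in> topspace T. f x \<in> U})" by blast
    moreover have "{x \<in> topspace T. f x \<in> S} \<inter> {x \<in> topspace T. f x \<in> U} =
        {x \<in> topspace T. f x \<in> S \<inter> U}" by auto
    moreover assume "S \<subseteq> f ` topspace T"
    ultimately show "S \<inter> U \<subseteq> f ` topspace T \<and> openin T {x \<in> topspace T. f x \<in> S \<inter> U}" by auto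
  next
    fix \<K> assume K: "\<forall>K\<in>\<K>. K \<subseteq> f ` topspace T \<and> openin T {x \<in> topspace T. f x \<in> K}"
    have "openin T (\<Union>K\<in>\<K>. {x \<in> topspace T. f x \<in> K})" using K by blast
    moreover have "(\<Union>K\<in>\<K>. {x \<in> topspace T. f x \<in> K}) = {x \<in> topspace T. f x \<in> \<Union>\<K>}" by auto
    ultimately show "\<Union>\<K> \<subseteq> f ` topspace T \<and> openin T {x \<in> topspace T. f x \<in> \<Union>\<K>}"
      using K by (auto simp: Union_least)
  qed
  then show ?thesis by (simp add: quotient_topology_def)
qed

lemma topspace_quotient_topology [simp]: "topspace (quotient_topology T f) = f ` topspace T"
proof
  have "{x \<in> topspace T. f x \<in> f ` topspace T} = topspace T" by auto
  then have "openin (quotient_topology T f) (f ` topspace T)"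
    by (simp add: openin_quotient_topology)
  then show "f ` topspace T \<subseteq> topspace (quotient_topology T f)" by (rule openin_subset)
  have "openin (quotient_topology T f) (topspace (quotient_topology T f))" by simp
  then show "topspace (quotient_topology T f) \<subseteq> f ` topspace T"
    by (simp only: openin_quotient_topology)
qed

definition geod_orbit :: "('a::metric_space \<Rightarrow> 'a) set \<Rightarrow> (real \<Rightarrow> 'a) \<Rightarrow> (real \<Rightarrow> 'a) set" where
  "geod_orbit \<Gamma> \<gamma> = (\<lambda>g. g \<circ> \<gamma>) ` \<Gamma>"

definition proj_geod_topology ::
    "('a::metric_space \<Rightarrow> 'a) set \<Rightarrow> (real \<Rightarrow> 'a) set topology" where
  "proj_geod_topology \<Gamma> = quotient_topology geod_topology (geod_orbit \<Gamma>)"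

definition geod_flow :: "real \<Rightarrow> (real \<Rightarrow> 'a) \<Rightarrow> (real \<Rightarrow> 'a)" where
  "geod_flow t \<gamma> = (\<lambda>s. \<gamma> (s + t))"

text \<open>The induced flow on orbits is taken elementwise, see \<open>proj_flow_orbit\<close>.\<close>

definition proj_flow :: "real \<Rightarrow> (real \<Rightarrow> 'a) set \<Rightarrow> (real \<Rightarrow> 'a) set" where
  "proj_flow t c = geod_flow t ` c"

lemma proj_flow_orbit: "proj_flow t (geod_orbit \<Gamma> \<gamma>) = geod_orbit \<Gamma> (geod_flow t \<gamma>)"
  by (auto simp: proj_flow_def geod_orbit_def geod_flow_def image_image comp_def)

definition borel_of :: "'b topology \<Rightarrow> 'b measure" where
  "borel_of T = sigma (topspace T) {U. openin T U}"

definition invariant_measure :: "'b measure \<Rightarrow> ('b \<Rightarrow> 'b) \<Rightarrow> bool" where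
  "invariant_measure M f \<longleftrightarrow> distr M M f = M"

definition ergodic_measure :: "'b measure \<Rightarrow> ('b \<Rightarrow> 'b) \<Rightarrow> bool" where
  "ergodic_measure M f \<longleftrightarrow> invariant_measure M f \<and>
     (\<forall>A\<in>sets M. f -` A \<inter> space M \<subseteq> A \<longrightarrow> measure M A \<in> {0, 1})"

lemma space_borel_of [simp]: "space (borel_of T) = topspace T"
  unfolding borel_of_def by (intro space_measure_of) (auto dest: openin_subset)

lemma sets_borel_of: "sets (borel_of T) = sigma_sets (topspace T) {U. openin T U}"
  unfolding borel_of_def by (intro sets_measure_of) (auto dest: openin_subset)

lemma geod_flow_in_Geod: "\<gamma> \<in> Geod \<Longrightarrow> geod_flow t \<gamma> \<in> Geod"
  by (auto simp: Geod_def isometric_on_def geod_flow_def dist_real_def)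

lemma geod_open_flow_vimage:
  assumes U: "geod_open U"
  shows "geod_open {\<gamma> \<in> Geod. geod_flow t \<gamma> \<in> U}"
  unfolding geod_open_def
proof (intro conjI ballI)
  fix \<gamma> assume \<gamma>: "\<gamma> \<in> {\<gamma> \<in> Geod. geod_flow t \<gamma> \<in> U}"
  then obtain K e where K: "compact K" "e > 0" "geod_nhd (geod_flow t \<gamma>) K e \<subseteq> U"
    using U unfolding geod_open_def by blast
  have "compact ((\<lambda>s. s + t) ` K)"
    using K(1) by (intro compact_continuous_image continuous_intros)
  moreover have "geod_nhd \<gamma> ((\<lambda>s. s + t) ` K) e \<subseteq> {\<gamma> \<in> Geod. geod_flow t \<gamma> \<in> U}"
  proof
    fix \<eta> assume \<eta>: "\<eta> \<in> geod_nhd \<gamma> ((\<lambda>s. s + t) ` K) e"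
    then have "geod_flow t \<eta> \<in> geod_nhd (geod_flow t \<gamma>) K e"
      using geod_flow_in_Geod[of \<eta> t] by (auto simp: geod_nhd_def geod_flow_def)
    then show "\<eta> \<in> {\<gamma> \<in> Geod. geod_flow t \<gamma> \<in> U}"
      using K(3) \<eta> by (auto simp: geod_nhd_def)
  qed
  ultimately show "\<exists>K. compact K \<and> (\<exists>e>0. geod_nhd \<gamma> K e \<subseteq> {\<gamma> \<in> Geod. geod_flow t \<gamma> \<in> U})"
    using K(2) by blast
qed auto

text \<open>The flow is measurable, so \<open>distr M M (proj_flow t)\<close> is the genuine push-forward.\<close>

lemma measurable_proj_flow:
  "proj_flow t \<in> borel_of (proj_geod_topology \<Gamma>) \<rightarrow>\<^sub>M borel_of (proj_geod_topology \<Gamma>)"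
proof (rule measurable_sigma_sets[OF sets_borel_of])
  let ?T = "proj_geod_topology \<Gamma>"
  show "{U. openin ?T U} \<subseteq> Pow (topspace ?T)" by (auto dest: openin_subset)
  show maps: "proj_flow t \<in> space (borel_of ?T) \<rightarrow> topspace ?T"
    by (auto simp: proj_geod_topology_def proj_flow_orbit geod_flow_in_Geod)
  fix V assume "V \<in> {U. openin ?T U}"
  then have "geod_open {\<gamma> \<in> Geod. geod_orbit \<Gamma> \<gamma> \<in> V}"
    by (simp add: proj_geod_topology_def openin_quotient_topology)
  from geod_open_flow_vimage[OF this, of t]
  have "geod_open {\<gamma> \<in> Geod. geod_orbit \<Gamma> \<gamma> \<in> proj_flow t -` V \<inter> space (borel_of ?T)}"
    by (rule back_subst[of geod_open])
       (auto simp: proj_flow_orbit geod_flow_in_Geod proj_geod_topology_def)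
  then have "openin ?T (proj_flow t -` V \<inter> space (borel_of ?T))"
    unfolding proj_geod_topology_def
    by (subst openin_quotient_topology) auto
  then show "proj_flow t -` V \<inter> space (borel_of ?T) \<in> sets (borel_of ?T)"
    by (auto simp: sets_borel_of)
qed

end

theory Submission
  imports Defs
begin

text \<open>For large \<open>R\<close> the open set of classes \<open>[\<gamma>]\<close> with \<open>d(\<gamma>(0), \<Gamma>x) < R\<close> has positive measure \<open>p\<close>.
  By Birkhoff's ergodic theorem almost every \<open>\<gamma>\<close> is within \<open>R\<close> of the orbit at integer times
  \<open>n\<^sub>0 < n\<^sub>1 < \<dots>\<close> with \<open>n\<^sub>k / k \<longlonglongrightarrow> 1 / p\<close>. A ray \<open>\<xi>\<close> from \<open>x\<close> to \<open>\<gamma>\<^sup>+\<close> can be chosen such that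
  \<open>d(\<xi>(t), \<gamma>(t))\<close> is bounded, so \<open>\<vartheta>\<^sub>k = n\<^sub>k\<close> and \<open>y\<^sub>k = \<xi>(n\<^sub>k)\<close> show that \<open>\<gamma>\<^sup>+\<close> lies in the ergodic
  limit set. The inverse flow is ergodic too and treats \<open>\<gamma>\<^sup>-\<close>.\<close>

subsection \<open>Birkhoff's theorem for ergodic maps\<close>

text \<open>The zero-one law is asked only of sets equal to their preimage. This form follows from
  the one with inclusion and is shared by a bijection and its inverse.\<close>

locale ergodic_map = prob_space M for M :: "'b measure" and T :: "'b \<Rightarrow> 'b" +
  assumes measurable_T [measurable]: "T \<in> M \<rightarrow>\<^sub>M M"
    and distr_T: "distr M M T = M"
    and ergodic: "\<And>A. A \<in> sets M \<Longrightarrow> T -` A \<inter> space M = A \<Longrightarrow> prob A \<in> {0, 1}"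
begin

lemma integrable_comp:
  fixes f :: "'b \<Rightarrow> real"
  assumes "integrable M f"
  shows "integrable M (\<lambda>\<omega>. f (T \<omega>))"
  using assms by (subst (asm) distr_T[symmetric]) (rule integrable_distr[OF measurable_T])

lemma integral_comp:
  fixes f :: "'b \<Rightarrow> real"
  assumes [measurable]: "f \<in> borel_measurable M"
  shows "(\<integral>\<omega>. f (T \<omega>) \<partial>M) = (\<integral>\<omega>. f \<omega> \<partial>M)"
  using integral_distr[OF measurable_T assms] by (simp add: distr_T)

section \<open>Birkhoff sums and the maximal inequality\<close>

definition birkhoff_sum :: "('b \<Rightarrow> real) \<Rightarrow> nat \<Rightarrow> 'b \<Rightarrow> real" where
  "birkhoff_sum f n \<omega> = (\<Sum>j<n. f ((T ^^ j) \<omega>))"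

lemma birkhoff_sum_Suc: "birkhoff_sum f (Suc n) \<omega> = f \<omega> + birkhoff_sum f n (T \<omega>)"
  unfolding birkhoff_sum_def
  by (subst sum.lessThan_Suc_shift) (simp add: funpow_Suc_right del: funpow.simps)

text \<open>\<open>max_sum f n\<close> is the maximum of the Birkhoff sums of length at most \<open>n\<close>, the empty sum
  included.\<close>

primrec max_sum :: "('b \<Rightarrow> real) \<Rightarrow> nat \<Rightarrow> 'b \<Rightarrow> real" where
  "max_sum f 0 = (\<lambda>\<omega>. 0)"
| "max_sum f (Suc n) = (\<lambda>\<omega>. max 0 (f \<omega> + max_sum f n (T \<omega>)))"

lemma max_sum_nonneg: "0 \<le> max_sum f n \<omega>"
  by (cases n) auto

lemma max_sum_mono: "max_sum f n \<omega> \<le> max_sum f (Suc n) \<omega>"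
proof (induction n arbitrary: \<omega>)
  case (Suc n)
  show ?case using Suc[of "T \<omega>"] by (simp only: max_sum.simps)
qed simp

lemma max_sum_mono': "m \<le> n \<Longrightarrow> max_sum f m \<omega> \<le> max_sum f n \<omega>"
  by (rule lift_Suc_mono_le[of "\<lambda>n. max_sum f n \<omega>"]) (use max_sum_mono in auto)

lemma birkhoff_sum_le_max_sum: "birkhoff_sum f n \<omega> \<le> max_sum f n \<omega>"
proof (induction n arbitrary: \<omega>)
  case 0
  then show ?case by (simp add: birkhoff_sum_def)
next
  case (Suc n)
  show ?case using Suc[of "T \<omega>"] by (simp add: birkhoff_sum_Suc)
qed

lemma integrable_max_sum:
  assumes "integrable M f"
  shows "integrable M (max_sum f n)"
proof (induction n)
  case (Suc n)
  have "integrable M (\<lambda>\<omega>. max 0 (f \<omega> + max_sum f n (T \<omega>)))"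
    by (intro Bochner_Integration.integrable_max Bochner_Integration.integrable_add
        integrable_comp[OF Suc] assms) simp
  then show ?case by simp
qed simp

text \<open>On the invariant set \<open>E\<close> where the Birkhoff sums are unbounded above, the differences
  \<open>max_sum f (Suc n) - max_sum f n \<circ> T\<close> have nonnegative integral and converge dominatedly to
  \<open>f\<close>; as \<open>f\<close> has negative integral, \<open>E\<close> cannot have full measure.\<close>

lemma AE_bdd_above_birkhoff_sum:
  assumes f: "integrable M f" and neg: "(\<integral>\<omega>. f \<omega> \<partial>M) < 0"
  shows "AE \<omega> in M. \<exists>B. \<forall>n. birkhoff_sum f n \<omega> \<le> B"
proof -
  note [measurable] = borel_measurable_integrable[OF f]
  have P [measurable]: "max_sum f n \<in> borel_measurable M" for n
    using integrable_max_sum[OF f] by simp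
  define E where "E = {\<omega> \<in> space M. \<forall>B::nat. \<exists>n. real B < max_sum f n \<omega>}"
  have E [measurable]: "E \<in> sets M" unfolding E_def by measurable
  have unbounded: "\<exists>n. B < max_sum f n \<omega>" if "\<omega> \<in> E" for \<omega> B
  proof -
    obtain b :: nat where "B \<le> real b" using real_arch_simple by blast
    then show ?thesis using that unfolding E_def by (blast intro: le_less_trans)
  qed
  have inv: "T \<omega> \<in> E \<longleftrightarrow> \<omega> \<in> E" if \<omega>: "\<omega> \<in> space M" for \<omega>
  proof
    assume T: "T \<omega> \<in> E"
    have "\<exists>n. real B < max_sum f n \<omega>" for B :: nat
    proof -
      obtain n where "real B - f \<omega> < max_sum f n (T \<omega>)" using unbounded[OF T] by blast
      then have "real B < max_sum f (Suc n) \<omega>" by simp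
      then show ?thesis by blast
    qed
    then show "\<omega> \<in> E" using \<omega> by (simp add: E_def)
  next
    assume T: "\<omega> \<in> E"
    have "\<exists>n. real B < max_sum f n (T \<omega>)" for B :: nat
    proof -
      \<comment> \<open>The bound \<open>0\<close> forces \<open>n\<close> to be a successor; the
        bound \<open>real B + f \<omega>\<close> then passes to \<open>T \<omega>\<close> by the
        recursion.\<close>
      obtain n where n: "max 0 (real B + f \<omega>) < max_sum f n \<omega>" using unbounded[OF T] by blast
      then obtain k where "n = Suc k" by (cases n) auto
      with n have "real B < max_sum f k (T \<omega>)" by (simp add: less_max_iff_disj)
      then show ?thesis by blast
    qed
    then show "T \<omega> \<in> E"
      using measurable_space[OF measurable_T \<omega>] by (simp add: E_def)
  qed
  have "T -` E \<inter> space M = E" using inv sets.sets_into_space[OF E] by blast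
  then have "prob E \<in> {0, 1}" by (rule ergodic[OF E])
  moreover have "prob E \<noteq> 1"
  proof
    assume "prob E = 1"
    then have AE_E: "AE \<omega> in M. \<omega> \<in> E" by (simp add: prob_eq_1)
    define D where "D n \<omega> = max_sum f (Suc n) \<omega> - max_sum f n (T \<omega>)" for n \<omega>
    have "0 \<le> (\<integral>\<omega>. D n \<omega> \<partial>M)" for n
    proof -
      \<comment> \<open>Invariance of the measure removes \<open>T\<close>, and
        \<open>max_sum\<close> increases with \<open>n\<close>.\<close>
      have "(\<integral>\<omega>. D n \<omega> \<partial>M) = (\<integral>\<omega>. max_sum f (Suc n) \<omega> \<partial>M) - (\<integral>\<omega>. max_sum f n \<omega> \<partial>M)"
        unfolding D_def integral_comp[OF P[of n], symmetric]
        by (intro Bochner_Integration.integral_diff integrable_comp[OF integrable_max_sum[OF f]]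
            integrable_max_sum[OF f])
      moreover have "(\<integral>\<omega>. max_sum f n \<omega> \<partial>M) \<le> (\<integral>\<omega>. max_sum f (Suc n) \<omega> \<partial>M)"
        by (intro integral_mono integrable_max_sum f max_sum_mono)
      ultimately show ?thesis by simp
    qed
    moreover have "(\<lambda>n. \<integral>\<omega>. D n \<omega> \<partial>M) \<longlonglongrightarrow> (\<integral>\<omega>. f \<omega> \<partial>M)"
    proof (rule integral_dominated_convergence[where w = "\<lambda>\<omega>. \<bar>f \<omega>\<bar>"])
      show "AE \<omega> in M. (\<lambda>n. D n \<omega>) \<longlonglongrightarrow> f \<omega>"
        using AE_E AE_space
      proof eventually_elim
        case (elim \<omega>)
        \<comment> \<open>From this \<open>n\<close> on the maximum with \<open>0\<close> is
          inactive, so \<open>D\<close> is constantly \<open>f \<omega>\<close>.\<close>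
        then obtain n where n: "- f \<omega> < max_sum f n (T \<omega>)"
          using inv[of \<omega>] unbounded[of "T \<omega>"] by auto
        have "D m \<omega> = f \<omega>" if "n \<le> m" for m
          using n max_sum_mono'[OF that, of f "T \<omega>"] by (simp add: D_def)
        then show ?case
          by (intro tendsto_eventually eventually_sequentiallyI[of n]) auto
      qed
      \<comment> \<open>\<open>D n \<omega>\<close> is the larger of \<open>f \<omega>\<close> and
        \<open>- max_sum f n (T \<omega>)\<close>; the latter is at most 0, which bounds the
        modulus.\<close>
      show "AE \<omega> in M. norm (D n \<omega>) \<le> \<bar>f \<omega>\<bar>" for n
      proof (rule AE_I2)
        fix \<omega>
        show "norm (D n \<omega>) \<le> \<bar>f \<omega>\<bar>"
          using max_sum_nonneg[of f n "T \<omega>"] by (simp add: D_def)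
      qed
      show "D n \<in> borel_measurable M" for n
        unfolding D_def using P by (intro borel_measurable_diff measurable_compose[OF measurable_T P])
    qed (use f in simp_all)
    ultimately have "0 \<le> (\<integral>\<omega>. f \<omega> \<partial>M)" by (intro LIMSEQ_le_const) auto
    with neg show False by simp
  qed
  ultimately have "prob E = 0" by simp
  then have "AE \<omega> in M. \<omega> \<notin> E" by (simp add: prob_eq_0)
  then show ?thesis
    using AE_space
  proof eventually_elim
    case (elim \<omega>)
    then obtain B :: nat where "\<And>n. max_sum f n \<omega> \<le> real B"
      by (auto simp: E_def not_less)
    then show ?case
      by (intro exI[of _ "real B"] allI order_trans[OF birkhoff_sum_le_max_sum])
  qed
qed

section \<open>From bounded sums to convergence of averages\<close>

lemma birkhoff_sum_affine:
  "birkhoff_sum (\<lambda>\<omega>. a * f \<omega> - b) n \<omega> = a * birkhoff_sum f n \<omega> - b * real n"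
  by (simp add: birkhoff_sum_def sum_subtractf sum_distrib_left)

text \<open>Subtracting slightly more than the mean from \<open>f\<close> or from \<open>- f\<close>
  leaves a negative integral, so the resulting Birkhoff sums are bounded above; dividing by
  \<open>n\<close> controls limsup and liminf. The excesses \<open>inverse (real (Suc k))\<close>
  keep the number of null sets countable.\<close>

theorem birkhoff_ergodic:
  assumes f: "integrable M f"
  shows "AE \<omega> in M. (\<lambda>n. birkhoff_sum f n \<omega> / real n) \<longlonglongrightarrow> (\<integral>\<omega>. f \<omega> \<partial>M)"
proof -
  let ?I = "\<integral>\<omega>. f \<omega> \<partial>M"
  have one_sided: "AE \<omega> in M. \<forall>k. \<exists>B. \<forall>n.
      a * birkhoff_sum f n \<omega> - (a * ?I + inverse (real (Suc k))) * real n \<le> B" for a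
  proof -
    have "AE \<omega> in M. \<exists>B. \<forall>n. birkhoff_sum (\<lambda>\<omega>. a * f \<omega> - (a * ?I + inverse (real (Suc k)))) n \<omega> \<le> B"
      for k
      using f by (intro AE_bdd_above_birkhoff_sum) (auto simp: prob_space)
    then show ?thesis by (simp add: birkhoff_sum_affine AE_all_countable)
  qed
  have limsup: "\<forall>\<^sub>F n in sequentially. s n / real n < c + e"
    if bounds: "\<And>k. \<exists>B. \<forall>n. s n - (c + inverse (real (Suc k))) * real n \<le> B" and "0 < e"
    for s :: "nat \<Rightarrow> real" and c e
  proof -
    obtain k where k: "inverse (real (Suc k)) < e / 2"
      using reals_Archimedean[of "e / 2"] \<open>0 < e\<close> by auto
    obtain B where B: "\<And>n. s n - (c + inverse (real (Suc k))) * real n \<le> B"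
      using bounds[of k] by blast
    have "(\<lambda>n. B / real n) \<longlonglongrightarrow> 0" by (rule lim_const_over_n)
    then have "\<forall>\<^sub>F n in sequentially. B / real n < e / 2"
      using \<open>0 < e\<close> by (intro order_tendstoD) auto
    then show ?thesis
      using eventually_gt_at_top[of 0]
    proof eventually_elim
      case (elim n)
      have "s n / real n \<le> B / real n + (c + inverse (real (Suc k)))"
        using B[of n] elim(2) by (simp add: field_simps del: of_nat_Suc)
      then show ?case using elim(1) k by linarith
    qed
  qed
  show ?thesis
    using one_sided[of 1] one_sided[of "-1"]
  proof eventually_elim
    case (elim \<omega>)
    show ?case
    proof (rule order_tendstoI)
      fix a assume "?I < a"
      then show "\<forall>\<^sub>F n in sequentially. birkhoff_sum f n \<omega> / real n < a"
        using limsup[of "\<lambda>n. 1 * birkhoff_sum f n \<omega>" "1 * ?I" "a - ?I"] elim(1) by simp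
    next
      fix a assume "a < ?I"
      then have "\<forall>\<^sub>F n in sequentially. - 1 * birkhoff_sum f n \<omega> / real n < - 1 * ?I + (?I - a)"
        using elim(2) by (intro limsup) auto
      then show "\<forall>\<^sub>F n in sequentially. a < birkhoff_sum f n \<omega> / real n"
        by (simp add: minus_less_iff)
    qed
  qed
qed

corollary visit_frequency:
  assumes [measurable]: "U \<in> sets M"
  shows "AE \<omega> in M. (\<lambda>n. real (card {j. j < n \<and> (T ^^ j) \<omega> \<in> U}) / real n) \<longlonglongrightarrow> prob U"
proof -
  have "birkhoff_sum (indicator U) n \<omega> = real (card {j. j < n \<and> (T ^^ j) \<omega> \<in> U})" for n \<omega>
    unfolding birkhoff_sum_def indicator_def
    by (simp add: sum.If_cases flip: sum.inter_filter) (simp add: Int_def)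
  then show ?thesis using birkhoff_ergodic[of "indicator U"] by (simp add: less_top[symmetric])
qed

end

subsection \<open>Sets of naturals with a density\<close>

text \<open>Indices start at 0, so there is no shift by one. The counting function of
  \<open>V\<close> thus inverts \<open>enumerate V\<close>.\<close>

lemma card_less_enumerate:
  fixes V :: "nat set"
  assumes "infinite V"
  shows "card {j. j < enumerate V k \<and> j \<in> V} = k"
proof -
  have "{j. j < enumerate V k \<and> j \<in> V} = enumerate V ` {..<k}"
  proof (intro equalityI subsetI)
    fix j assume j: "j \<in> {j. j < enumerate V k \<and> j \<in> V}"
    then obtain i where "j = enumerate V i" using enumerate_Ex[OF assms] by blast
    with j show "j \<in> enumerate V ` {..<k}" by (simp add: enumerate_mono_iff[OF assms])
  qed (use enumerate_in_set[OF assms] enumerate_mono[OF _ assms] in auto)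
  then show ?thesis
    using inj_on_subset[OF inj_enumerate[OF assms]] by (simp add: card_image)
qed

text \<open>A finite set has density 0. For an infinite one, evaluating the frequency at
  \<open>n = enumerate V k\<close> gives \<open>k / enumerate V k\<close>, and reciprocals yield the
  claim.\<close>

lemma enumerate_density:
  fixes V :: "nat set"
  assumes lim: "(\<lambda>n. real (card {j. j < n \<and> j \<in> V}) / real n) \<longlonglongrightarrow> p" and "0 < p"
  shows "infinite V" and "(\<lambda>k. real (enumerate V k) / real k) \<longlonglongrightarrow> inverse p"
proof -
  show inf: "infinite V"
  proof
    assume V: "finite V"
    have "(\<lambda>n. real (card V) / real n) \<longlonglongrightarrow> 0" by (rule lim_const_over_n)
    with lim have "p \<le> 0"
      by (rule LIMSEQ_le) (auto intro!: exI[of _ 0] divide_right_mono card_mono V)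
    with \<open>0 < p\<close> show False by simp
  qed
  have "filterlim (enumerate V) at_top sequentially"
    using inf by (intro filterlim_subseq) (simp add: strict_mono_def enumerate_mono_iff)
  from filterlim_compose[OF lim this]
  have "(\<lambda>k. real k / real (enumerate V k)) \<longlonglongrightarrow> p"
    by (simp add: card_less_enumerate[OF inf])
  then show "(\<lambda>k. real (enumerate V k) / real k) \<longlonglongrightarrow> inverse p"
    using \<open>0 < p\<close> tendsto_inverse[of "\<lambda>k. real k / real (enumerate V k)" p] by simp
qed

subsection \<open>Rays in hyperbolic spaces\<close>

lemma gromov_product_commute: "gromov_product x y z = gromov_product x z y"
  by (simp add: gromov_product_def dist_commute)

lemma hyperbolicD:
  assumes "hyperbolic_space TYPE('a::metric_space) \<delta>"
  shows "min (gromov_product w x y) (gromov_product w y z) - \<delta> \<le> gromov_product w x (z::'a)"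
  using assms by (simp add: hyperbolic_space_def)

lemma gromov_related_iff:
  "gromov_related x u v \<longleftrightarrow>
     (\<forall>C. \<exists>N. \<forall>n\<ge>N. \<forall>m\<ge>N. C \<le> gromov_product x (u n) (v m))"
  unfolding gromov_related_def filterlim_at_top eventually_prod_sequentially case_prod_conv by blast

lemma gromov_related_sym:
  assumes "gromov_related x u v"
  shows "gromov_related x v u"
  using assms unfolding gromov_related_iff by (metis gromov_product_commute)

lemma gromov_related_trans:
  fixes x :: "'a::metric_space"
  assumes hyp: "hyperbolic_space TYPE('a) \<delta>"
    and uv: "gromov_related x u v" and vw: "gromov_related x v w"
  shows "gromov_related x u w"
  unfolding gromov_related_iff
proof
  fix C
  \<comment> \<open>The extra \<open>\<delta>\<close> pays for the loss in the hyperbolic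
    inequality, where \<open>v (max N K)\<close> is the middle point.\<close>
  obtain N where N: "\<And>n m. N \<le> n \<Longrightarrow> N \<le> m \<Longrightarrow> C + \<delta> \<le> gromov_product x (u n) (v m)"
    using uv unfolding gromov_related_iff by meson
  obtain K where K: "\<And>n m. K \<le> n \<Longrightarrow> K \<le> m \<Longrightarrow> C + \<delta> \<le> gromov_product x (v n) (w m)"
    using vw unfolding gromov_related_iff by meson
  have "C \<le> gromov_product x (u n) (w m)" if "max N K \<le> n" "max N K \<le> m" for n m
    using N[of n "max N K"] K[of "max N K" m] that
      hyperbolicD[OF hyp, of x "u n" "v (max N K)" "w m"] by simp
  then show "\<exists>N. \<forall>n\<ge>N. \<forall>m\<ge>N. C \<le> gromov_product x (u n) (w m)" by blast
qed

text \<open>Symmetry and transitivity make both sequences related to themselves, so they are Gromov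
  sequences.\<close>

lemma boundary_class_eqI:
  fixes x :: "'a::metric_space"
  assumes "hyperbolic_space TYPE('a) \<delta>" and "gromov_related x u v"
  shows "boundary_class x u = boundary_class x v"
proof -
  have vu: "gromov_related x v u" using assms(2) by (rule gromov_related_sym)
  note trans = gromov_related_trans[OF assms(1)]
  have "gromov_related x u u" "gromov_related x v v"
    using trans[OF assms(2) vu] trans[OF vu assms(2)] by auto
  moreover have "gromov_related x u w \<longleftrightarrow> gromov_related x v w" for w
    using trans[OF assms(2)] trans[OF vu] by blast
  ultimately show ?thesis
    by (simp add: boundary_class_def boundary_rel_def gromov_sequences_def Image_def)
qed

lemma boundary_class_in_boundary:
  "gromov_related x u u \<Longrightarrow> boundary_class x u \<in> boundary x"
  by (simp add: boundary_class_def boundary_def quotientI gromov_sequences_def)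

text \<open>Seen from \<open>\<gamma> 0\<close>, the product of \<open>\<gamma> n\<close> and
  \<open>\<gamma> m\<close> is the minimum of \<open>n\<close> and \<open>m\<close>. Moving the base
  point to \<open>x\<close> costs at most \<open>dist x (\<gamma> 0)\<close>, and replacing
  \<open>\<gamma> m\<close> by \<open>\<xi> m\<close> at most \<open>C\<close>.\<close>

lemma gromov_related_geodesic:
  assumes "geodesic_ray \<gamma>" and close: "\<And>t. 0 \<le> t \<Longrightarrow> dist (\<gamma> t) (\<xi> t) \<le> C"
  shows "gromov_related x (\<lambda>n. \<gamma> (real n)) (\<lambda>n. \<xi> (real n))"
  unfolding gromov_related_iff
proof
  fix B
  obtain N :: nat where N: "B + dist x (\<gamma> 0) + C \<le> real N" using real_arch_simple by blast
  have "B \<le> gromov_product x (\<gamma> (real n)) (\<xi> (real m))" if "N \<le> n" "N \<le> m" for n m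
  proof -
    have "dist (\<gamma> (real n)) (\<gamma> (real m)) \<le> real n + real m - 2 * real N"
         "dist (\<gamma> 0) (\<gamma> (real n)) = real n" "dist (\<gamma> 0) (\<gamma> (real m)) = real m"
      using assms(1) that by (auto simp: geodesic_ray_def isometric_on_def dist_real_def)
    moreover have "dist (\<gamma> (real m)) (\<xi> (real m)) \<le> C" using close by simp
    ultimately show ?thesis
      using N dist_triangle[of "\<gamma> (real n)" "\<xi> (real m)" "\<gamma> (real m)"]
        dist_triangle2[of x "\<gamma> (real m)" "\<xi> (real m)"]
        dist_triangle3[of "\<gamma> 0" "\<gamma> (real n)" x] dist_triangle3[of "\<gamma> 0" "\<gamma> (real m)" x]
      by (simp add: gromov_product_def field_simps)
  qed
  then show "\<exists>N. \<forall>n\<ge>N. \<forall>m\<ge>N. B \<le> gromov_product x (\<gamma> (real n)) (\<xi> (real m))" by blast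
qed

text \<open>The Gromov products of \<open>\<gamma> t\<close> and of \<open>c t\<close> with the common endpoint \<open>\<gamma> s\<close> are at
  least \<open>t\<close> up to a constant, and hyperbolicity transfers this to the pair \<open>\<gamma> t\<close>, \<open>c t\<close>.\<close>

lemma segment_fellow_travels:
  fixes x :: "'a::metric_space"
  assumes hyp: "hyperbolic_space TYPE('a) \<delta>" and "geodesic_ray \<gamma>"
    and c: "isometric_on {0..dist x (\<gamma> s)} c" "c 0 = x" "c (dist x (\<gamma> s)) = \<gamma> s"
    and t: "0 \<le> t" "t \<le> s" "t \<le> dist x (\<gamma> s)"
  shows "dist (\<gamma> t) (c t) \<le> 3 * dist x (\<gamma> 0) + 2 * \<delta>"
proof -
  have \<gamma>: "dist (\<gamma> t) (\<gamma> s) = s - t" "dist (\<gamma> 0) (\<gamma> t) = t" "dist (\<gamma> 0) (\<gamma> s) = s"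
    using assms(2) t by (auto simp: geodesic_ray_def isometric_on_def dist_real_def)
  have iso: "dist (c a) (c b) = \<bar>a - b\<bar>" if "a \<in> {0..dist x (\<gamma> s)}" "b \<in> {0..dist x (\<gamma> s)}" for a b
    using c(1) that by (simp add: isometric_on_def dist_real_def)
  have c': "dist x (c t) = t" "dist (c t) (\<gamma> s) = dist x (\<gamma> s) - t"
    using iso[of 0 t] iso[of t "dist x (\<gamma> s)"] c(2,3) t by simp_all
  have "t - dist x (\<gamma> 0) \<le> gromov_product x (\<gamma> t) (\<gamma> s)"
    using \<gamma> dist_triangle[of "\<gamma> 0" "\<gamma> t" x] dist_triangle[of "\<gamma> 0" "\<gamma> s" x]
    by (simp add: gromov_product_def dist_commute)
  moreover have "gromov_product x (\<gamma> s) (c t) = t"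
    using c' by (simp add: gromov_product_def dist_commute)
  ultimately have "t - dist x (\<gamma> 0) - \<delta> \<le> gromov_product x (\<gamma> t) (c t)"
    using hyperbolicD[OF hyp, of x "\<gamma> t" "\<gamma> s" "c t"] zero_le_dist[of x "\<gamma> 0"] by linarith
  \<comment> \<open>Doubling the Gromov product gives two copies of
    \<open>dist x (\<gamma> 0)\<close>; the third comes from \<open>dist x (\<gamma> t)\<close>,
    which is at most \<open>dist x (\<gamma> 0) + t\<close>.\<close>
  then show ?thesis
    using c' \<gamma> dist_triangle[of x "\<gamma> t" "\<gamma> 0"] by (simp add: gromov_product_def)
qed

text \<open>Arzela-Ascoli for rays: as pointwise limits of isometric maps are isometric, Tychonoff's
  theorem suffices.\<close>

lemma ray_fellow_travels:
  fixes x :: "'a::metric_space"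
  assumes proper: "proper_space TYPE('a)" and geodesic: "geodesic_space TYPE('a)"
    and hyp: "hyperbolic_space TYPE('a) \<delta>" and \<gamma>: "geodesic_ray \<gamma>"
  obtains \<xi> where "geodesic_ray \<xi>" "\<xi> 0 = x"
    "\<And>t. 0 \<le> t \<Longrightarrow> dist (\<gamma> t) (\<xi> t) \<le> 3 * dist x (\<gamma> 0) + 2 * \<delta>"
proof -
  let ?C = "3 * dist x (\<gamma> 0) + 2 * \<delta>"
  \<comment> \<open>Properness makes each factor compact. Negative times occur because rays are
    encoded as functions on all reals.\<close>
  define K where "K = (\<Pi>\<^sub>E t\<in>UNIV. cball x \<bar>t\<bar>)"
  \<comment> \<open>Each condition involves at most two coordinates of \<open>f\<close>, so
    \<open>F N\<close> is closed under pointwise limits.\<close>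
  define F where "F N = {f. (\<forall>s\<in>{0..real N}. \<forall>t\<in>{0..real N}. dist (f s) (f t) = dist s t) \<and>
      f 0 = x \<and> (\<forall>t\<in>{0..real N}. dist (\<gamma> t) (f t) \<le> ?C)}" for N
  have "compactin (product_topology (\<lambda>_. euclidean) UNIV) K"
    using proper unfolding K_def compactin_PiE by (simp add: proper_space_def)
  then have "compact K" by (simp add: euclidean_product_topology)
  moreover have "closed (F N)" for N
    unfolding F_def Ball_def
    by (intro closed_Collect_conj closed_Collect_all closed_Collect_imp open_Collect_const closed_Collect_eq
        closed_Collect_le continuous_on_dist continuous_on_const continuous_on_product_coordinates)
  moreover have "K \<inter> (\<Inter>N\<in>I. F N) \<noteq> {}" if I: "finite I" for I
  proof -
    obtain M where M: "\<And>N. N \<in> I \<Longrightarrow> N \<le> M"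
      using I unfolding finite_nat_set_iff_bounded_le by blast
    \<comment> \<open>The added distance makes the segment from \<open>x\<close> to
      \<open>\<gamma> s\<close> at least \<open>M\<close> long, so one segment serves every
      \<open>N\<close> in \<open>I\<close>.\<close>
    define s where "s = real M + dist x (\<gamma> 0)"
    define L where "L = dist x (\<gamma> s)"
    obtain c where c: "isometric_on {0..L} c" "c 0 = x" "c L = \<gamma> s"
      using geodesic unfolding geodesic_space_def L_def by blast
    have "0 \<le> s" by (simp add: s_def)
    then have "dist (\<gamma> 0) (\<gamma> s) = s"
      using \<gamma> by (auto simp: geodesic_ray_def isometric_on_def dist_real_def)
    then have L: "real M \<le> L" using dist_triangle[of "\<gamma> 0" "\<gamma> s" x]
      by (simp add: L_def s_def dist_commute)
    \<comment> \<open>Outside the segment the value \<open>x\<close> keeps \<open>f\<close> in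
      \<open>K\<close>.\<close>
    define f where "f t = (if t \<in> {0..L} then c t else x)" for t
    have f: "dist (f t) (f t') = dist t t'" if "t \<in> {0..L}" "t' \<in> {0..L}" for t t'
      using c(1) that by (simp add: isometric_on_def f_def)
    have "f \<in> K"
    proof -
      have "dist x (f t) \<le> \<bar>t\<bar>" for t
        using f[of 0 t] c(2) by (cases "t \<in> {0..L}") (auto simp: f_def split: if_splits)
      then show ?thesis by (simp add: K_def PiE_iff)
    qed
    moreover have "f \<in> F N" if "N \<in> I" for N
    proof -
      have "real N \<le> real M" using M[OF that] by simp
      moreover have "dist (\<gamma> t) (c t) \<le> ?C" if "0 \<le> t" "t \<le> real M" for t
      proof (rule segment_fellow_travels[OF hyp \<gamma>])
        show "t \<le> s" using that by (simp add: s_def add_increasing2)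
      qed (use c L that in \<open>auto simp: L_def\<close>)
      ultimately show ?thesis
        using f L c(2) by (auto simp: F_def f_def)
    qed
    ultimately show ?thesis by blast
  qed
  ultimately have "K \<inter> (\<Inter>N\<in>UNIV. F N) \<noteq> {}"
    by (rule compact_imp_fip_image)
  then obtain \<xi> where \<xi>: "\<And>N. \<xi> \<in> F N" by blast
  show ?thesis
  proof
    show "geodesic_ray \<xi>"
      unfolding geodesic_ray_def isometric_on_def
    proof (intro ballI)
      fix s t :: real assume st: "s \<in> {0..}" "t \<in> {0..}"
      obtain N :: nat where "max s t \<le> real N" using real_arch_simple by blast
      then show "dist (\<xi> s) (\<xi> t) = dist s t" using \<xi>[of N] st by (simp add: F_def)
    qed
    show "\<xi> 0 = x" using \<xi>[of 0] by (simp add: F_def)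
    fix t :: real assume "0 \<le> t"
    obtain N :: nat where "t \<le> real N" using real_arch_simple by blast
    then show "dist (\<gamma> t) (\<xi> t) \<le> ?C" using \<xi>[of N] \<open>0 \<le> t\<close> by (simp add: F_def)
  qed
qed

lemma pos_end_in_ergodic_limit_set:
  fixes x :: "'a::metric_space"
  assumes "proper_space TYPE('a)" and "geodesic_space TYPE('a)"
    and hyp: "hyperbolic_space TYPE('a) \<delta>" and \<gamma>: "geodesic_ray \<gamma>"
    and p: "0 < p"
      "(\<lambda>n. real (card {j. j < n \<and> infdist (\<gamma> (real j)) ((\<lambda>g. g x) ` \<Gamma>) < R}) / real n) \<longlonglongrightarrow> p"
  shows "pos_end x \<gamma> \<in> ergodic_limit_set \<Gamma> x"
proof -
  define C where "C = 3 * dist x (\<gamma> 0) + 2 * \<delta>"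
  obtain \<xi> where \<xi>: "geodesic_ray \<xi>" "\<xi> 0 = x" "\<And>t. 0 \<le> t \<Longrightarrow> dist (\<gamma> t) (\<xi> t) \<le> C"
    using ray_fellow_travels[OF assms(1-4)] unfolding C_def by blast
  define V where "V = {j. infdist (\<gamma> (real j)) ((\<lambda>g. g x) ` \<Gamma>) < R}"
  define \<theta> where "\<theta> k = real (enumerate V k)" for k
  have V: "infinite V" "(\<lambda>k. \<theta> k / real k) \<longlonglongrightarrow> inverse p"
    using enumerate_density[of V p] p by (auto simp: V_def \<theta>_def)
  have mono: "strict_mono (enumerate V)"
    using V(1) by (simp add: strict_mono_def)
  have "filterlim \<theta> at_top sequentially"
    unfolding \<theta>_def
    by (intro filterlim_compose[OF filterlim_real_sequentially] filterlim_subseq mono)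
  then have \<theta>: "\<theta> \<in> ergodic_sequences"
    using V mono p(1) by (auto simp: ergodic_sequences_def \<theta>_def strict_mono_def
        intro!: exI[of _ "inverse p"])
  \<comment> \<open>Distance to the orbit is 1-Lipschitz, hence \<open>C + R\<close>; the maximum
    with 1 ensures \<open>0 < \<tau>\<close>.\<close>
  define \<tau> where "\<tau> = max 1 (C + R)"
  have "\<exists>y\<in>\<xi> ` {0..}. dist x y \<in> {\<theta> i..\<theta> (Suc i)} \<and> infdist y ((\<lambda>g. g x) ` \<Gamma>) \<le> \<tau>" for i
  proof (intro bexI conjI)
    have "dist (\<xi> 0) (\<xi> (\<theta> i)) = \<theta> i"
      using \<xi>(1) by (auto simp: geodesic_ray_def isometric_on_def dist_real_def \<theta>_def)
    then show "dist x (\<xi> (\<theta> i)) \<in> {\<theta> i..\<theta> (Suc i)}"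
      using \<xi>(2) mono by (auto simp: \<theta>_def strict_mono_def intro!: less_imp_le)
    have "infdist (\<gamma> (\<theta> i)) ((\<lambda>g. g x) ` \<Gamma>) < R"
      using enumerate_in_set[OF V(1), of i] by (simp add: V_def \<theta>_def)
    then show "infdist (\<xi> (\<theta> i)) ((\<lambda>g. g x) ` \<Gamma>) \<le> \<tau>"
      using infdist_triangle[of "\<xi> (\<theta> i)" "(\<lambda>g. g x) ` \<Gamma>" "\<gamma> (\<theta> i)"] \<xi>(3)[of "\<theta> i"]
      by (simp add: \<tau>_def dist_commute \<theta>_def)
  qed (simp add: \<theta>_def)
  moreover have "gromov_related x (\<lambda>n. \<gamma> (real n)) (\<lambda>n. \<xi> (real n))"
    using \<gamma> \<xi>(3) by (rule gromov_related_geodesic)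
  then have "pos_end x \<gamma> = pos_end x \<xi>"
    unfolding pos_end_def by (rule boundary_class_eqI[OF hyp])
  \<comment> \<open>Comparing \<open>\<gamma>\<close> with itself at distance 0 shows that it
    defines a boundary point.\<close>
  moreover have "pos_end x \<gamma> \<in> boundary x"
    unfolding pos_end_def
    using gromov_related_geodesic[OF \<gamma>, of \<gamma> 0] by (intro boundary_class_in_boundary) simp
  ultimately have "pos_end x \<gamma> \<in> limit_set_along \<Gamma> x \<tau> \<theta>"
    using \<xi> by (auto simp: limit_set_along_def)
  moreover have "0 < \<tau>" by (simp add: \<tau>_def)
  ultimately show ?thesis using \<theta> by (auto simp: ergodic_limit_set_def)
qed

subsection \<open>Visits to neighbourhoods of the orbit\<close>

lemma proj_flow_add: "proj_flow s (proj_flow t c) = proj_flow (s + t) c"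
  by (auto simp: proj_flow_def geod_flow_def image_image algebra_simps)

lemma proj_flow_0: "proj_flow 0 c = c"
  by (simp add: proj_flow_def geod_flow_def)

lemma funpow_proj_flow: "(proj_flow t ^^ j) c = proj_flow (real j * t) c"
  by (induction j) (simp_all add: proj_flow_0 proj_flow_add algebra_simps)

section \<open>Distance to the orbit of the base point\<close>

lemma infdist_isometry:
  assumes "isometric_on UNIV g"
  shows "infdist (g y) (g ` A) = infdist y A"
  using assms by (simp add: infdist_def image_image isometric_on_def)

lemma subgroup_isom_groupD:
  assumes "subgroup \<Gamma> isom_group"
  shows "id \<in> \<Gamma>" and "g \<in> \<Gamma> \<Longrightarrow> isometric_on UNIV g"
    and "g \<in> \<Gamma> \<Longrightarrow> h \<in> \<Gamma> \<Longrightarrow> g \<circ> h \<in> \<Gamma>"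
    and "g \<in> \<Gamma> \<Longrightarrow> \<exists>k\<in>\<Gamma>. g \<circ> k = id"
proof -
  show "id \<in> \<Gamma>" using subgroup.one_closed[OF assms] by (simp add: isom_group_def)
  show "isometric_on UNIV g" if "g \<in> \<Gamma>"
    using subgroup.mem_carrier[OF assms that] by (simp add: isom_group_def)
  show "g \<circ> h \<in> \<Gamma>" if "g \<in> \<Gamma>" "h \<in> \<Gamma>"
    using subgroup.m_closed[OF assms that] by (simp add: isom_group_def)
  show "\<exists>k\<in>\<Gamma>. g \<circ> k = id" if "g \<in> \<Gamma>"
  proof
    show "m_inv isom_group g \<in> \<Gamma>"
      by (rule subgroup.m_inv_closed[OF assms that])
    show "g \<circ> m_inv isom_group g = id"
      using group.r_inv[OF group_isom_group subgroup.mem_carrier[OF assms that]]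
      by (simp add: isom_group_def)
  qed
qed

text \<open>The isometry \<open>g\<close> permutes the orbit of \<open>x\<close>. Hence distance to
  the orbit gives a well-defined condition on classes of geodesics.\<close>

lemma infdist_orbit:
  assumes \<Gamma>: "subgroup \<Gamma> isom_group" and g: "g \<in> \<Gamma>"
  shows "infdist (g y) ((\<lambda>h. h x) ` \<Gamma>) = infdist y ((\<lambda>h. h x) ` \<Gamma>)"
proof -
  note D = subgroup_isom_groupD[OF \<Gamma>]
  have "g ` (\<lambda>h. h x) ` \<Gamma> = (\<lambda>h. h x) ` \<Gamma>"
  proof (intro equalityI subsetI)
    fix z assume "z \<in> g ` (\<lambda>h. h x) ` \<Gamma>"
    then obtain h where "h \<in> \<Gamma>" "z = (g \<circ> h) x" by auto
    then show "z \<in> (\<lambda>h. h x) ` \<Gamma>" using D(3)[OF g] by blast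
  next
    fix z assume "z \<in> (\<lambda>h. h x) ` \<Gamma>"
    then obtain h where h: "h \<in> \<Gamma>" "z = h x" by blast
    obtain k where k: "k \<in> \<Gamma>" "g \<circ> k = id" using D(4)[OF g] by blast
    have "z = g ((k \<circ> h) x)" using h(2) k(2) by (metis comp_apply id_apply)
    then show "z \<in> g ` (\<lambda>h. h x) ` \<Gamma>" using D(3)[OF k(1) h(1)] by blast
  qed
  then show ?thesis using infdist_isometry[OF D(2)[OF g], of y "(\<lambda>h. h x) ` \<Gamma>"] by simp
qed

text \<open>One representative within \<open>R\<close> is asked for; for a subgroup
  \<open>\<Gamma>\<close>, invariance of the distance extends this to all. The strict inequality
  makes the set open, hence measurable.\<close>

definition near_orbit :: "('a::metric_space \<Rightarrow> 'a) set \<Rightarrow> 'a \<Rightarrow> real \<Rightarrow> (real \<Rightarrow> 'a) set set" where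
  "near_orbit \<Gamma> x R = {geod_orbit \<Gamma> \<gamma> |\<gamma>. \<gamma> \<in> Geod \<and> infdist (\<gamma> 0) ((\<lambda>g. g x) ` \<Gamma>) < R}"

lemma near_orbit_iff:
  assumes \<Gamma>: "subgroup \<Gamma> isom_group" and "\<gamma> \<in> Geod"
  shows "geod_orbit \<Gamma> \<gamma> \<in> near_orbit \<Gamma> x R \<longleftrightarrow> infdist (\<gamma> 0) ((\<lambda>g. g x) ` \<Gamma>) < R"
proof
  assume "geod_orbit \<Gamma> \<gamma> \<in> near_orbit \<Gamma> x R"
  then obtain \<eta> where \<eta>: "geod_orbit \<Gamma> \<gamma> = geod_orbit \<Gamma> \<eta>" "infdist (\<eta> 0) ((\<lambda>g. g x) ` \<Gamma>) < R"
    by (auto simp: near_orbit_def)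
  have "id \<circ> \<gamma> \<in> geod_orbit \<Gamma> \<gamma>"
    unfolding geod_orbit_def using subgroup_isom_groupD(1)[OF \<Gamma>] by blast
  with \<eta>(1) obtain g where "g \<in> \<Gamma>" "\<gamma> = g \<circ> \<eta>" by (auto simp: geod_orbit_def)
  then show "infdist (\<gamma> 0) ((\<lambda>g. g x) ` \<Gamma>) < R" using \<eta>(2) infdist_orbit[OF \<Gamma>] by simp
qed (use assms(2) in \<open>auto simp: near_orbit_def\<close>)

text \<open>Distance to the orbit is 1-Lipschitz, so closeness at time 0 alone, with the slack below
  \<open>R\<close> as tolerance, suffices.\<close>

lemma openin_near_orbit:
  assumes "subgroup \<Gamma> isom_group"
  shows "openin (proj_geod_topology \<Gamma>) (near_orbit \<Gamma> x R)"
  unfolding proj_geod_topology_def openin_quotient_topology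
proof
  show "near_orbit \<Gamma> x R \<subseteq> geod_orbit \<Gamma> ` topspace geod_topology"
    by (auto simp: near_orbit_def)
  let ?d = "\<lambda>\<gamma> :: real \<Rightarrow> 'a. infdist (\<gamma> 0) ((\<lambda>g. g x) ` \<Gamma>)"
  have "geod_open {\<gamma> \<in> Geod. ?d \<gamma> < R}"
    unfolding geod_open_def
  proof (intro conjI ballI)
    fix \<gamma> assume \<gamma>: "\<gamma> \<in> {\<gamma> \<in> Geod. ?d \<gamma> < R}"
    have "?d \<eta> < R" if "\<eta> \<in> geod_nhd \<gamma> {0} (R - ?d \<gamma>)" for \<eta>
      using that infdist_triangle[of "\<eta> 0" "(\<lambda>g. g x) ` \<Gamma>" "\<gamma> 0"]
      by (simp add: geod_nhd_def dist_commute)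
    then have "geod_nhd \<gamma> {0} (R - ?d \<gamma>) \<subseteq> {\<gamma> \<in> Geod. ?d \<gamma> < R}"
      by (auto simp: geod_nhd_def)
    then show "\<exists>K. compact K \<and> (\<exists>e>0. geod_nhd \<gamma> K e \<subseteq> {\<gamma> \<in> Geod. ?d \<gamma> < R})"
      using \<gamma> by (intro exI[of _ "{0}"] conjI exI[of _ "R - ?d \<gamma>"]) auto
  qed auto
  then show "openin geod_topology {\<gamma> \<in> topspace geod_topology. geod_orbit \<Gamma> \<gamma> \<in> near_orbit \<Gamma> x R}"
    using near_orbit_iff[OF assms] by (auto elim!: back_subst[of geod_open])
qed

text \<open>The sign \<open>\<sigma>\<close> covers both ends: \<open>\<sigma> = - 1\<close> turns
  the backward half of a line into a ray.\<close>

lemma AE_end_in_ergodic_limit_set: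
  fixes x :: "'a::metric_space" and \<sigma> :: real
  assumes "proper_space TYPE('a)" and "geodesic_space TYPE('a)"
    and "hyperbolic_space TYPE('a) \<delta>" and \<Gamma>: "subgroup \<Gamma> isom_group"
    and sets: "sets \<mu> = sets (borel_of (proj_geod_topology \<Gamma>))"
    and "ergodic_map \<mu> (proj_flow \<sigma>)" and \<sigma>: "\<bar>\<sigma>\<bar> = 1"
  shows "AE c in \<mu>. \<forall>\<gamma>\<in>c. pos_end x (\<lambda>t. \<gamma> (\<sigma> * t)) \<in> ergodic_limit_set \<Gamma> x"
proof -
  interpret ergodic_map \<mu> "proj_flow \<sigma>" by fact
  have space: "space \<mu> = geod_orbit \<Gamma> ` Geod"
    using sets_eq_imp_space_eq[OF sets] by (simp add: proj_geod_topology_def)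
  have meas: "near_orbit \<Gamma> x R \<in> events" for R
    using openin_near_orbit[OF \<Gamma>] by (auto simp: sets sets_borel_of)
  \<comment> \<open>The sets with natural \<open>R\<close> exhaust the space, so they cannot all be
    null.\<close>
  have "\<exists>R. 0 < prob (near_orbit \<Gamma> x R)"
  proof (rule ccontr)
    assume "\<not> ?thesis"
    then have "AE c in \<mu>. c \<notin> near_orbit \<Gamma> x R" for R
      using prob_eq_0[OF meas[of R]] by (simp add: not_less measure_le_0_iff)
    then have away: "AE c in \<mu>. \<forall>n::nat. c \<notin> near_orbit \<Gamma> x (real n)"
      by (simp add: AE_all_countable)
    have near: "\<exists>n::nat. c \<in> near_orbit \<Gamma> x (real n)" if c: "c \<in> space \<mu>" for c
    proof -
      obtain \<gamma> where \<gamma>: "\<gamma> \<in> Geod" "c = geod_orbit \<Gamma> \<gamma>" using c space by blast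
      obtain n where "infdist (\<gamma> 0) ((\<lambda>g. g x) ` \<Gamma>) < real n" using reals_Archimedean2 by blast
      then show ?thesis using near_orbit_iff[OF \<Gamma> \<gamma>(1)] \<gamma>(2) by blast
    qed
    have "AE c in \<mu>. False"
      using away AE_space by eventually_elim (use near in blast)
    then show False by simp
  qed
  then obtain R where R: "0 < prob (near_orbit \<Gamma> x R)" by blast
  show ?thesis
    using visit_frequency[OF meas[of R]] AE_space
  proof eventually_elim
    case (elim c)
    show ?case
    proof
      fix \<gamma> assume "\<gamma> \<in> c"
      with elim(2) obtain \<eta> g where c: "c = geod_orbit \<Gamma> \<eta>" "\<eta> \<in> Geod" "g \<in> \<Gamma>" "\<gamma> = g \<circ> \<eta>"
        unfolding space by (auto simp: geod_orbit_def)
      \<comment> \<open>By invariance, visits of the class are visits of each representative along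
        its ray in direction \<open>\<sigma>\<close>.\<close>
      have visit: "(proj_flow \<sigma> ^^ j) c \<in> near_orbit \<Gamma> x R \<longleftrightarrow>
          infdist (\<gamma> (\<sigma> * real j)) ((\<lambda>g. g x) ` \<Gamma>) < R" for j
      proof -
        have "(proj_flow \<sigma> ^^ j) c = geod_orbit \<Gamma> (geod_flow (real j * \<sigma>) \<eta>)"
          by (simp add: funpow_proj_flow c(1) proj_flow_orbit)
        then show ?thesis
          using near_orbit_iff[OF \<Gamma> geod_flow_in_Geod[OF c(2)]] infdist_orbit[OF \<Gamma> c(3)]
          by (simp add: geod_flow_def c(4) mult.commute)
      qed
      have "isometric_on UNIV g" using subgroup_isom_groupD(2)[OF \<Gamma> c(3)] .
      then have "dist (\<gamma> (\<sigma> * s)) (\<gamma> (\<sigma> * t)) = dist s t" for s t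
        using c(2) \<sigma> by (simp add: c(4) Geod_def isometric_on_def dist_real_def abs_mult
            flip: right_diff_distrib)
      then have "geodesic_ray (\<lambda>t. \<gamma> (\<sigma> * t))"
        by (simp add: geodesic_ray_def isometric_on_def)
      then show "pos_end x (\<lambda>t. \<gamma> (\<sigma> * t)) \<in> ergodic_limit_set \<Gamma> x"
        using elim(1) R assms(1-3)
        by (intro pos_end_in_ergodic_limit_set[where p = "prob (near_orbit \<Gamma> x R)" and R = R])
           (simp_all add: visit)
    qed
  qed
qed

text \<open>Pushing \<open>distr M M T = M\<close> forward by \<open>S\<close> gives invariance.
  Being mutually inverse, \<open>S\<close> and \<open>T\<close> have the same measurable sets equal
  to their preimage.\<close>

lemma ergodic_map_inverse:
  assumes "ergodic_map M T" and S: "S \<in> M \<rightarrow>\<^sub>M M"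
    and ST: "\<And>\<omega>. S (T \<omega>) = \<omega>" and TS: "\<And>\<omega>. T (S \<omega>) = \<omega>"
  shows "ergodic_map M S"
proof -
  interpret ergodic_map M T by fact
  show ?thesis
  proof
    have "distr M M S = distr (distr M M T) M S" by (simp add: distr_T)
    also have "\<dots> = distr M M (S \<circ> T)" using S by (simp add: distr_distr)
    also have "\<dots> = M" by (simp add: comp_def ST)
    finally show "distr M M S = M" .
    fix A assume A: "A \<in> events" and inv: "S -` A \<inter> space M = A"
    have "T \<omega> \<in> A \<longleftrightarrow> \<omega> \<in> A" if "\<omega> \<in> space M" for \<omega>
      using that inv ST measurable_space[OF measurable_T] by (metis IntD1 IntI vimage_eq)
    then have "T -` A \<inter> space M = A"
      using sets.sets_into_space[OF A] by blast
    then show "prob A \<in> {0, 1}" by (rule ergodic[OF A])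
  qed (rule S)
qed

theorem theorem3:
  fixes x :: "'a::metric_space" and \<delta> :: real
    and \<Gamma> :: "('a \<Rightarrow> 'a) set" and \<mu> :: "(real \<Rightarrow> 'a) set measure"
  assumes "proper_space TYPE('a)"
    and "geodesic_space TYPE('a)"
    and "\<delta> \<ge> 0"
    and "hyperbolic_space TYPE('a) \<delta>"
    and "subgroup \<Gamma> isom_group"
    and "discrete_isometries \<Gamma>"
    and "sets \<mu> = sets (borel_of (proj_geod_topology \<Gamma>))"
    and "prob_space \<mu>"
    and "invariant_measure \<mu> (proj_flow 1)"
    and "ergodic_measure \<mu> (proj_flow 1)"
  shows "AE c in \<mu>. \<forall>\<gamma>\<in>c. pos_end x \<gamma> \<in> ergodic_limit_set \<Gamma> x \<and>
                        neg_end x \<gamma> \<in> ergodic_limit_set \<Gamma> x"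
proof -
  interpret \<mu>: prob_space \<mu> by fact
  have meas: "proj_flow t \<in> \<mu> \<rightarrow>\<^sub>M \<mu>" for t
    using measurable_proj_flow[of t \<Gamma>] assms(7) measurable_cong_sets by blast
  have fwd: "ergodic_map \<mu> (proj_flow 1)"
  proof
    show "distr \<mu> \<mu> (proj_flow 1) = \<mu>" using assms(9) by (simp add: invariant_measure_def)
    show "\<mu>.prob A \<in> {0, 1}" if "A \<in> sets \<mu>" "proj_flow 1 -` A \<inter> space \<mu> = A" for A
      using assms(10) that unfolding ergodic_measure_def by blast
  qed (rule meas)
  \<comment> \<open>Reversing the flow exchanges the two ends, so the inverse of the time-one map
    handles \<open>neg_end\<close>.\<close>
  then have "ergodic_map \<mu> (proj_flow (- 1))"
    by (rule ergodic_map_inverse) (simp_all add: meas proj_flow_add proj_flow_0)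
  with fwd have "AE c in \<mu>. \<forall>\<gamma>\<in>c. pos_end x (\<lambda>t. \<gamma> (1 * t)) \<in> ergodic_limit_set \<Gamma> x"
    and "AE c in \<mu>. \<forall>\<gamma>\<in>c. pos_end x (\<lambda>t. \<gamma> (- 1 * t)) \<in> ergodic_limit_set \<Gamma> x"
    by (intro AE_end_in_ergodic_limit_set[OF assms(1,2,4,5,7)]; simp)+
  then show ?thesis
    by eventually_elim (simp add: pos_end_def neg_end_def)
qed

end
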